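(* Let $\hat{x}\in\mathbb{C}^n$ be such that $\hat y:=M\hat x$ satisfies $|\hat y|^2=r$ (i.e. $\hat y$ is a solution of the feasibility problem: find $y\in A\cap B$, where $A=M(\mathbb{C}^n)$ and $B=\{y\in\mathbb{C}^N : |y|^2=r\}$), and assume $\min_{1\le i\le N} r_i>0$. Put $Y:=\operatorname{diag}\left(\hat y/|\hat y|\right)\in\mathbb{C}^{N\times N}$ and $L:=Y^*M\in\mathbb{C}^{N\times n}$. Suppose that $$\sigma_2:=\max\left\{\|\operatorname{Im}(Lx)\| : x\in\mathbb{C}^n,\ \|x\|=1,\ x\perp \mathrm{j}\hat x\right\}<1 .$$ Let $y^{(k+1)}\in T_{\mathtt{DRAP}}(y^{(k)})$ $(k=0,1,2,\ldots)$ be a sequence generated by $T_{\mathtt{DRAP}}$ with $y^{(0)}=Mx^{(0)}$ for some $x^{(0)}\in\mathbb{C}^n$, and put $x^{(k)}:=M^*y^{(k)}$ for $k=1,2,\ldots$. If $x^{(0)}$ is sufficiently close to $\hat x$, then there exists a number $c\in(\sigma_2,1)$ such that $$\operatorname{dist}_{\rm opt}(x^{(k)},\hat x)\le c^k\operatorname{dist}_{\rm opt}(x^{(0)},\hat x)\qquad\text{for all }k\in\mathbb{N}.$$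
   Context: $m\ge 2$ and $n$ are positive integers, $N=mn$, $\mathrm{j}=\sqrt{-1}$. The propagation matrix is $$M=\frac{1}{\sqrt m}\begin{pmatrix}FD_1\\ FD_2\\ \vdots\\ FD_m\end{pmatrix}\in\mathbb{C}^{N\times n},$$ where $F\in\mathbb{C}^{n\times n}$ is the unitary matrix representing the discrete Fourier transform and $D_1,\dots,D_m\in\mathbb{C}^{n\times n}$ are unitary matrices (representing the addition of phase diversities); thus $M^*M=I_n$. $r\in\mathbb{R}_+^N$ is the data vector. Absolute value, square, square root and division of vectors are entrywise, $\odot$ is entrywise multiplication, $\operatorname{Im}$ is the entrywise imaginary part, $\operatorname{diag}(v)$ is the diagonal matrix with diagonal $v$, and $\|\cdot\|$ is the Euclidean norm. Orthogonality $x\perp u$ of complex vectors is with respect to the real inner product $\langle x,u\rangle=\operatorname{Re}(x^*u)$. With relaxation parameter $\lambda\in[0,1]$, the DRAP operator (no a priori constraint) is $$T_{\mathtt{DRAP}}(y)=\lambda(I_N-MM^* )y+\left((1+\lambda)MM^*-\lambda I_N\right)\left(\sqrt r\odot\frac{y}{|y|}\right),\quad y\in\mathbb{C}^N,$$ which is set-valued in general: if $y_i=0$, the entry $y_i/|y_i|$ may be any complex number of modulus one. $\operatorname{dist}_{\rm opt}(x,u):=\min_{\alpha\in\mathbb{C},|\alpha|=1}\|\alpha x-u\|$. *)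

theory Defs
  imports "HOL-Analysis.Analysis"
begin

text \<open>
  Complex \<open>n\<close>-space is the type \<open>complex ^ 'n\<close>. Its library norm is the Euclidean norm, and its
  library inner product \<open>x \<bullet> u\<close> is the real inner product \<open>Re (x\<^sup>* u)\<close> (see \<open>inner_complex_vec\<close>),
  so that \<open>orthogonal\<close> is orthogonality in the real sense.
  The \<open>N = m n\<close> rows of the propagation matrix are indexed by pairs in \<open>'m \<times> 'n\<close>:
  block first, position in the block second.
\<close>

lemma inner_complex_vec:
  fixes x u :: "complex ^ 'n"
  shows "x \<bullet> u = Re (\<Sum>i\<in>UNIV. cnj (x $ i) * u $ i)"
  by (simp add: inner_vec_def inner_complex_def)

definition ctranspose :: "complex ^ 'n ^ 'm \<Rightarrow> complex ^ 'm ^ 'n" where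
  "ctranspose A = (\<chi> i j. cnj (A $ j $ i))"

definition unitary_matrix :: "complex ^ 'n ^ 'n \<Rightarrow> bool" where
  "unitary_matrix U \<longleftrightarrow> ctranspose U ** U = mat 1 \<and> U ** ctranspose U = mat 1"

definition diag_matrix :: "complex ^ 'n \<Rightarrow> complex ^ 'n ^ 'n" where
  "diag_matrix v = (\<chi> i j. if i = j then v $ i else 0)"

definition Im_vec :: "complex ^ 'n \<Rightarrow> real ^ 'n" where
  "Im_vec v = (\<chi> i. Im (v $ i))"

text \<open>
  The function \<open>pos\<close> numbers the coordinates; it is meant to be a bijection from the index type
  onto \<open>{..<n}\<close>, where \<open>n = CARD('n)\<close>.
\<close>

definition dft_matrix :: "('n::finite \<Rightarrow> nat) \<Rightarrow> complex ^ 'n ^ 'n" where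
  "dft_matrix pos = (\<chi> k l.
     exp (- 2 * of_real pi * \<i> * of_nat (pos k) * of_nat (pos l) / of_nat CARD('n))
       / of_real (sqrt (real CARD('n))))"

definition propagation_matrix ::
    "('n::finite \<Rightarrow> nat) \<Rightarrow> ('m::finite \<Rightarrow> complex ^ 'n ^ 'n) \<Rightarrow> complex ^ 'n ^ ('m \<times> 'n)" where
  "propagation_matrix pos D =
     (1 / sqrt (real CARD('m))) *\<^sub>R (\<chi> q. (dft_matrix pos ** D (fst q)) $ snd q)"

text \<open>All admissible values of the entrywise quotient \<open>y / \<bar>y\<bar>\<close>.\<close>

definition phases :: "complex ^ 'a \<Rightarrow> (complex ^ 'a) set" where
  "phases y = {p. \<forall>i. if y $ i = 0 then cmod (p $ i) = 1
                      else p $ i = y $ i / of_real (cmod (y $ i))}"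

definition T_DRAP ::
    "complex ^ 'n ^ 'a \<Rightarrow> real ^ 'a \<Rightarrow> real \<Rightarrow> complex ^ 'a \<Rightarrow> (complex ^ 'a) set" where
  "T_DRAP M r lam y =
     {lam *\<^sub>R ((mat 1 - M ** ctranspose M) *v y)
        + ((1 + lam) *\<^sub>R (M ** ctranspose M) - lam *\<^sub>R mat 1)
            *v (\<chi> i. of_real (sqrt (r $ i)) * p $ i) | p. p \<in> phases y}"

definition phase_matrix :: "complex ^ 'a \<Rightarrow> complex ^ 'a ^ 'a" where
  "phase_matrix y = diag_matrix (\<chi> i. y $ i / of_real (cmod (y $ i)))"

text \<open>The infimum and the supremum below are attained; see the lemmas that follow them.\<close>

definition dist_opt :: "complex ^ 'n \<Rightarrow> complex ^ 'n \<Rightarrow> real" where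
  "dist_opt x u = (INF \<alpha> \<in> {\<alpha>. cmod \<alpha> = 1}. norm (\<alpha> *s x - u))"

definition sigma2 :: "complex ^ 'n ^ 'a \<Rightarrow> complex ^ 'n \<Rightarrow> real" where
  "sigma2 M xhat =
     (let L = ctranspose (phase_matrix (M *v xhat)) ** M
      in Sup {norm (Im_vec (L *v x)) | x. norm x = 1 \<and> orthogonal x (\<i> *s xhat)})"

lemma dist_opt_attained:
  fixes x u :: "complex ^ 'n"
  shows "\<exists>\<alpha>. cmod \<alpha> = 1 \<and> dist_opt x u = norm (\<alpha> *s x - u)
           \<and> (\<forall>\<beta>. cmod \<beta> = 1 \<longrightarrow> norm (\<alpha> *s x - u) \<le> norm (\<beta> *s x - u))"
proof -
  have S: "{\<alpha>::complex. cmod \<alpha> = 1} = sphere 0 1" by auto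
  have "continuous_on (sphere 0 1) (\<lambda>\<alpha>::complex. norm (\<alpha> *s x - u))"
    unfolding vector_scalar_mult_def by (intro continuous_intros)
  then obtain a where a: "a \<in> sphere 0 1"
      "\<And>b. b \<in> sphere 0 1 \<Longrightarrow> norm (a *s x - u) \<le> norm (b *s x - u)"
    using continuous_attains_inf[of "sphere (0::complex) 1" "\<lambda>\<alpha>. norm (\<alpha> *s x - u)"] by auto
  have "dist_opt x u = norm (a *s x - u)"
    unfolding dist_opt_def S by (intro cInf_eq_minimum) (use a in auto)
  with a show ?thesis by (intro exI[of _ a]) auto
qed

lemma sigma2_attained:
  fixes M :: "complex ^ 'n ^ 'a" and xhat :: "complex ^ 'n"
  defines "L \<equiv> ctranspose (phase_matrix (M *v xhat)) ** M"
  shows "\<exists>x. norm x = 1 \<and> orthogonal x (\<i> *s xhat) \<and> sigma2 M xhat = norm (Im_vec (L *v x))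
           \<and> (\<forall>z. norm z = 1 \<and> orthogonal z (\<i> *s xhat)
                 \<longrightarrow> norm (Im_vec (L *v z)) \<le> norm (Im_vec (L *v x)))"
proof -
  let ?K = "sphere 0 1 \<inter> {x. orthogonal x (\<i> *s xhat)}"
  let ?f = "\<lambda>x. norm (Im_vec (L *v x))"
  have "closed {x. orthogonal x (\<i> *s xhat)}"
    unfolding orthogonal_def by (intro closed_Collect_eq continuous_intros)
  then have K: "compact ?K" by (intro compact_Int_closed) auto
  have "DIM(complex ^ 'n) \<ge> 2" by simp
  then obtain x0 where x0: "x0 \<noteq> 0" "orthogonal (\<i> *s xhat) x0"
    using orthogonal_to_vector_exists [of "\<i> *s xhat"] by blast
  have "x0 /\<^sub>R norm x0 \<in> ?K"
    using x0 by (simp add: orthogonal_commute orthogonal_clauses)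
  then have ne: "?K \<noteq> {}" by blast
  have "continuous_on ?K ?f"
    unfolding Im_vec_def matrix_vector_mult_def by (simp, intro continuous_intros)
  then obtain x where x: "x \<in> ?K" "\<And>z. z \<in> ?K \<Longrightarrow> ?f z \<le> ?f x"
    using continuous_attains_sup[OF K ne] by blast
  have "sigma2 M xhat = ?f x"
    unfolding sigma2_def Let_def L_def[symmetric]
    by (intro cSup_eq_maximum) (use x in auto)
  with x show ?thesis by (intro exI[of _ x]) auto
qed

end

theory Submission
  imports Defs
begin

text \<open>
  Up to the diagonal unitary \<open>Y\<close>, the magnitude constraint \<open>B\<close> can be viewed from the point
  \<open>b = \<bar>M xhat\<bar>\<close>, which has positive real entries. There the projection onto \<open>B\<close> is
  \<open>b + d \<mapsto> b + \<i> Im d + O(\<bar>d\<bar>\<^sup>2)\<close>, so DRAP linearizes to a relaxed Douglas--Rachford map for two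
  real subspaces: the range of the isometry \<open>L = Y\<^sup>* M\<close>, with projection \<open>P = L L\<^sup>*\<close>, and the imaginary
  vectors. On a deviation \<open>a\<close> the linear map is
  \<open>lin a = P (\<i> Im a) + lam (I - P) (Re a)\<close>, whose two summands are orthogonal.

  On imaginary vectors orthogonal to \<open>\<i> b\<close>, the projection \<open>P\<close> contracts by \<open>\<sigma>\<^sub>2\<close>, by duality with
  the definition of \<open>\<sigma>\<^sub>2\<close> (\<open>proj_imaginary_contraction\<close>). On the real parts of the range of \<open>L\<close>,
  \<open>I - P\<close> contracts by the same factor, because \<open>\<parallel>Re L x\<parallel>\<^sup>2 + \<parallel>Im L x\<parallel>\<^sup>2 = \<parallel>x\<parallel>\<^sup>2\<close>
  (\<open>coproj_real_contraction\<close>). These two bounds make \<open>lin\<close> a \<open>\<sigma>\<^sub>2\<close>-contraction in the Euclidean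
  norm, uniformly in \<open>lam\<close> (\<open>lin_contraction\<close>), and this is why the estimate needs no constant in
  front of \<open>c ^ k\<close>.

  Two families of directions are not contracted. The direction \<open>\<i> b\<close> is tangent to the orbit of the
  global phase, under which DRAP is equivariant, and every step is followed by an optimal change of
  phase (\<open>exists_phase\<close>). The other family consists of the real vectors \<open>n\<close> with \<open>L\<^sup>* n = 0\<close>, which
  the linearization multiplies by \<open>lam\<close>, possibly \<open>1\<close>. They do not affect \<open>L\<^sup>* y\<close>, and moving from
  \<open>b\<close> to \<open>b + n\<close> with small \<open>n\<close> does not change the projection onto \<open>B\<close>; hence the linearization error is of the
  form \<open>O((\<bar>a\<bar> + \<bar>n\<bar>) \<bar>a\<bar>)\<close>, with the contracted part \<open>a\<close> as a factor
  (\<open>magnitude_projection_error\<close>). Near the solution one step therefore gives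
  \<open>\<bar>a'\<bar> \<le> c \<bar>a\<bar>\<close> and \<open>\<bar>n'\<bar> \<le> \<bar>n\<bar> + (1 - c) \<bar>a\<bar>\<close> with \<open>c = (1 + \<sigma>\<^sub>2) / 2\<close>, so that
  \<open>\<bar>a\<bar> + \<bar>n\<bar>\<close> never increases and the estimate can be iterated (\<open>drap_step\<close>). The start
  \<open>y = M x\<close> has \<open>n = 0\<close> and \<open>\<bar>a\<bar>\<close> equal to the optimal distance of \<open>x\<close> and \<open>xhat\<close>.
\<close>

section \<open>Complex matrices and the real inner product\<close>

lemma inner_ctranspose:
  fixes A :: "complex ^ 'n ^ 'a"
  shows "(A *v x) \<bullet> y = x \<bullet> (ctranspose A *v y)"
proof -
  have "(\<Sum>i\<in>UNIV. cnj ((A *v x) $ i) * y $ i)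
      = (\<Sum>i\<in>UNIV. \<Sum>j\<in>UNIV. cnj (A $ i $ j) * cnj (x $ j) * y $ i)"
    by (simp add: matrix_vector_mult_def sum_distrib_right)
  also have "\<dots> = (\<Sum>j\<in>UNIV. \<Sum>i\<in>UNIV. cnj (A $ i $ j) * cnj (x $ j) * y $ i)"
    by (rule sum.swap)
  also have "\<dots> = (\<Sum>j\<in>UNIV. cnj (x $ j) * (ctranspose A *v y) $ j)"
    by (simp add: matrix_vector_mult_def ctranspose_def sum_distrib_left mult_ac)
  finally show ?thesis
    by (simp add: inner_complex_vec)
qed

lemma ctranspose_ctranspose [simp]: "ctranspose (ctranspose A) = A"
  by (simp add: ctranspose_def vec_eq_iff)

lemma ctranspose_mult: "ctranspose (A ** B) = ctranspose B ** ctranspose A"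
  by (simp add: ctranspose_def vec_eq_iff matrix_matrix_mult_def mult.commute)

lemma norm_isometry:
  fixes L :: "complex ^ 'n ^ 'a"
  assumes "ctranspose L ** L = mat 1"
  shows "norm (L *v x) = norm x"
  by (simp add: norm_eq_sqrt_inner inner_ctranspose matrix_vector_mul_assoc assms)

lemma norm_smult:
  fixes v :: "complex ^ 'a"
  shows "norm (\<alpha> *s v) = cmod \<alpha> * norm v"
  by (simp add: norm_vec_def L2_set_def norm_mult power_mult_distrib
    flip: sum_distrib_left real_sqrt_mult) (simp add: real_sqrt_mult)

lemma matrix_scaleR_vec:
  fixes L :: "complex ^ 'n ^ 'a"
  shows "L *v (c *\<^sub>R x) = c *\<^sub>R (L *v x)" "(c *\<^sub>R L) *v x = c *\<^sub>R (L *v x)"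
  by (simp_all add: matrix_vector_mult_def vec_eq_iff scaleR_right.sum)

lemma matrix_diff_vec:
  fixes A B :: "complex ^ 'n ^ 'a"
  shows "(A - B) *v x = A *v x - B *v x"
  by (simp add: matrix_vector_mult_def vec_eq_iff left_diff_distrib sum_subtractf)

section \<open>Real and imaginary parts of complex vectors\<close>

text \<open>
  The splitting into real and imaginary vectors is the orthogonal one of the real inner product
  space, so \<open>ivec\<close> retains the factor \<open>\<i>\<close> and both parts remain complex vectors.
\<close>

definition rvec :: "complex ^ 'a \<Rightarrow> complex ^ 'a" where
  "rvec v = (\<chi> i. of_real (Re (v $ i)))"

definition ivec :: "complex ^ 'a \<Rightarrow> complex ^ 'a" where
  "ivec v = (\<chi> i. \<i> * of_real (Im (v $ i)))"

lemma rvec_plus_ivec: "rvec v + ivec v = v"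
  by (simp add: rvec_def ivec_def vec_eq_iff complex_eq_iff)

lemma rvec_linear: "linear rvec"
  by (rule linearI) (simp_all add: rvec_def vec_eq_iff complex_eq_iff)

lemma ivec_linear: "linear ivec"
  by (rule linearI) (simp_all add: ivec_def vec_eq_iff complex_eq_iff)

lemmas rvec_simps = linear_add[OF rvec_linear] linear_diff[OF rvec_linear]
  linear_cmul[OF rvec_linear] linear_0[OF rvec_linear]
lemmas ivec_simps = linear_add[OF ivec_linear] linear_diff[OF ivec_linear]
  linear_cmul[OF ivec_linear] linear_0[OF ivec_linear]

lemma rvec_rvec [simp]: "rvec (rvec v) = rvec v"
  and ivec_ivec [simp]: "ivec (ivec v) = ivec v"
  by (simp_all add: rvec_def ivec_def vec_eq_iff)

lemma inner_rvec_ivec [simp]: "rvec v \<bullet> ivec w = 0" "ivec w \<bullet> rvec v = 0"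
  by (simp_all add: rvec_def ivec_def inner_vec_def inner_complex_def)

lemma inner_rvec_left: "rvec v \<bullet> w = rvec v \<bullet> rvec w"
  by (metis add.right_neutral inner_add_right inner_rvec_ivec(1) rvec_plus_ivec)

lemma inner_ivec_left: "ivec v \<bullet> w = ivec v \<bullet> ivec w"
  by (metis add.left_neutral inner_add_right inner_rvec_ivec(2) rvec_plus_ivec)

lemma norm_rvec_ivec: "(norm v)\<^sup>2 = (norm (rvec v))\<^sup>2 + (norm (ivec v))\<^sup>2"
  by (metis norm_add_Pythagorean orthogonal_def inner_rvec_ivec(1) rvec_plus_ivec)

lemma norm_ivec: "norm (ivec v) = norm (Im_vec v)"
  by (simp add: norm_vec_def L2_set_def ivec_def Im_vec_def norm_mult)

section \<open>Optimal alignment of the global phase\<close>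

text \<open>
  The phase that makes the Hermitian product of \<open>v\<close> and \<open>\<alpha> u\<close> a nonnegative real number is the
  best one, because the distance of \<open>\<alpha> u\<close> and \<open>v\<close> depends on \<open>\<alpha>\<close> only through the real part of
  that product. The last bound says that little turning is required when \<open>u\<close> is nearly aligned.
\<close>

lemma exists_phase:
  fixes u v :: "complex ^ 'a"
  shows "\<exists>\<alpha>. cmod \<alpha> = 1 \<and> (\<alpha> *s u) \<bullet> (\<i> *s v) = 0
    \<and> (\<forall>\<beta>. cmod \<beta> = 1 \<longrightarrow> norm (\<alpha> *s u - v) \<le> norm (\<beta> *s u - v))
    \<and> (0 < u \<bullet> v \<longrightarrow> cmod (\<alpha> - 1) \<le> 2 * \<bar>u \<bullet> (\<i> *s v)\<bar> / (u \<bullet> v))"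
proof -
  define s where "s = (\<Sum>i\<in>UNIV. cnj (v $ i) * u $ i)"
  have in1: "(\<beta> *s u) \<bullet> v = Re (\<beta> * s)" for \<beta>
    by (subst inner_commute) (simp add: inner_complex_vec s_def sum_distrib_left mult_ac del: Re_sum)
  have in2: "(\<beta> *s u) \<bullet> (\<i> *s v) = Im (\<beta> * s)" for \<beta>
  proof -
    have "(\<Sum>i\<in>UNIV. cnj (\<i> * v $ i) * (\<beta> * u $ i)) = - \<i> * (\<beta> * s)"
      by (simp add: s_def sum_distrib_left mult_ac sum_negf)
    then show ?thesis
      by (subst inner_commute) (simp add: inner_complex_vec del: Re_sum)
  qed
  obtain \<alpha> where \<alpha>: "cmod \<alpha> = 1" "\<alpha> * s = of_real (cmod s)"
  proof (cases "s = 0")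
    case True
    then show ?thesis using that[of 1] by simp
  next
    case False
    have "cnj s * s = of_real (cmod s) * of_real (cmod s)"
      using complex_norm_square[of s] by (simp add: power2_eq_square mult.commute)
    then show ?thesis
      using that[of "cnj s / of_real (cmod s)"] False by (simp add: norm_divide)
  qed
  have exp: "(norm (\<beta> *s u - v))\<^sup>2 = (norm u)\<^sup>2 + (norm v)\<^sup>2 - 2 * Re (\<beta> * s)" if "cmod \<beta> = 1" for \<beta>
  proof -
    have "(norm (\<beta> *s u - v))\<^sup>2 = (norm (\<beta> *s u))\<^sup>2 + (norm v)\<^sup>2 - 2 * ((\<beta> *s u) \<bullet> v)"
      by (simp only: power2_norm_eq_inner inner_diff_left inner_diff_right) (simp add: inner_commute)
    then show ?thesis using that by (simp add: in1 norm_smult)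
  qed
  have "norm (\<alpha> *s u - v) \<le> norm (\<beta> *s u - v)" if "cmod \<beta> = 1" for \<beta>
  proof (rule power2_le_imp_le)
    have "Re (\<beta> * s) \<le> cmod s" using complex_Re_le_cmod[of "\<beta> * s"] that by (simp add: norm_mult)
    then show "(norm (\<alpha> *s u - v))\<^sup>2 \<le> (norm (\<beta> *s u - v))\<^sup>2"
      using exp[OF that] exp[OF \<alpha>(1)] \<alpha>(2) by simp
  qed simp
  moreover have "cmod (\<alpha> - 1) \<le> 2 * \<bar>u \<bullet> (\<i> *s v)\<bar> / (u \<bullet> v)" if "0 < u \<bullet> v"
  proof -
    have Re: "u \<bullet> v = Re s" and Im: "u \<bullet> (\<i> *s v) = Im s"
      using in1[of 1] in2[of 1] by simp_all
    have "(\<alpha> - 1) * s = of_real (cmod s) - s" by (simp add: \<alpha>(2) left_diff_distrib)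
    then have "cmod (\<alpha> - 1) * cmod s = cmod (of_real (cmod s) - s)"
      by (simp flip: norm_mult)
    also have "\<dots> \<le> \<bar>cmod s - Re s\<bar> + \<bar>Im s\<bar>"
      using cmod_le[of "of_real (cmod s) - s"] by simp
    also have "\<dots> \<le> 2 * \<bar>Im s\<bar>"
      using cmod_le[of s] complex_Re_le_cmod[of s] that Re by simp
    finally have "cmod (\<alpha> - 1) * cmod s \<le> 2 * \<bar>Im s\<bar>" .
    moreover have "cmod (\<alpha> - 1) * Re s \<le> cmod (\<alpha> - 1) * cmod s"
      by (intro mult_left_mono complex_Re_le_cmod) auto
    ultimately show ?thesis using that unfolding Re Im by (simp add: pos_le_divide_eq)
  qed
  moreover have "(\<alpha> *s u) \<bullet> (\<i> *s v) = 0" by (simp only: in2 \<alpha>(2)) simp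
  ultimately show ?thesis using \<alpha>(1) by blast
qed

lemma dist_opt_le: "cmod \<alpha> = 1 \<Longrightarrow> dist_opt x u \<le> norm (\<alpha> *s x - u)"
  unfolding dist_opt_def by (rule cINF_lower) (auto intro!: bdd_belowI[of _ 0])

lemma dist_opt_aligned:
  fixes x u :: "complex ^ 'n"
  obtains \<alpha> where "cmod \<alpha> = 1" "(\<alpha> *s x) \<bullet> (\<i> *s u) = 0" "dist_opt x u = norm (\<alpha> *s x - u)"
proof -
  obtain \<alpha> where \<alpha>: "cmod \<alpha> = 1" "(\<alpha> *s x) \<bullet> (\<i> *s u) = 0"
    "\<And>\<beta>. cmod \<beta> = 1 \<Longrightarrow> norm (\<alpha> *s x - u) \<le> norm (\<beta> *s x - u)"
    using exists_phase[of x u] by blast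
  have "dist_opt x u = norm (\<alpha> *s x - u)"
    unfolding dist_opt_def by (rule cInf_eq_minimum) (use \<alpha> in auto)
  with \<alpha> that show ?thesis by blast
qed

section \<open>Invariance of the operator under changes of phase\<close>

lemma diag_matrix_vec: "diag_matrix \<theta> *v v = (\<chi> i. \<theta> $ i * v $ i)"
  by (simp add: diag_matrix_def matrix_vector_mult_def vec_eq_iff mult_delta_left mult_delta_right if_distrib[of cnj])

lemma diag_matrix_isometry:
  assumes "\<And>i. cmod (\<theta> $ i) = 1"
  shows "ctranspose (diag_matrix \<theta>) ** diag_matrix \<theta> = mat 1"
proof -
  have "cnj (\<theta> $ i) * \<theta> $ i = 1" for i
    using complex_norm_square[of "\<theta> $ i"] assms[of i] by (simp add: mult.commute)
  then show ?thesis
    by (simp add: vec_eq_iff matrix_matrix_mult_def ctranspose_def diag_matrix_def mat_def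
        mult_delta_left mult_delta_right if_distrib[of cnj])
qed

text \<open>
  Turning each entry by its own phase commutes with the projection onto the magnitudes and carries
  the range of \<open>M\<close> to that of the turned matrix. This reduces the theorem to a solution with
  positive real measurements.
\<close>

lemma T_DRAP_diag:
  fixes M :: "complex ^ 'n ^ 'a"
  assumes \<theta>: "\<And>i. cmod (\<theta> $ i) = 1" and y': "y' \<in> T_DRAP M r lam y"
  shows "diag_matrix \<theta> *v y' \<in> T_DRAP (diag_matrix \<theta> ** M) r lam (diag_matrix \<theta> *v y)"
proof -
  let ?U = "diag_matrix \<theta>"
  obtain p where p: "p \<in> phases y"
    and y'p: "y' = lam *\<^sub>R ((mat 1 - M ** ctranspose M) *v y)
        + ((1 + lam) *\<^sub>R (M ** ctranspose M) - lam *\<^sub>R mat 1)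
            *v (\<chi> i. of_real (sqrt (r $ i)) * p $ i)"
    using y' by (auto simp: T_DRAP_def)
  have undo_diag: "ctranspose ?U *v (?U *v v) = v" for v
    by (simp add: matrix_vector_mul_assoc diag_matrix_isometry \<theta>)
  have "\<theta> $ i \<noteq> 0" for i using \<theta>[of i] by auto
  then have Up: "?U *v p \<in> phases (?U *v y)"
    using p by (auto simp: phases_def diag_matrix_vec norm_mult \<theta>)
  have q: "(\<chi> i. of_real (sqrt (r $ i)) * (?U *v p) $ i) = ?U *v (\<chi> i. of_real (sqrt (r $ i)) * p $ i)"
    by (simp add: diag_matrix_vec vec_eq_iff mult_ac)
  show ?thesis
    unfolding T_DRAP_def mem_Collect_eq
    by (rule exI[of _ "?U *v p"])
      (simp only: q Up y'p ctranspose_mult matrix_diff_vec matrix_scaleR_vec undo_diag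
        matrix_vector_mul_lid matrix_vector_right_distrib matrix_vector_mult_diff_distrib
        simp_thms flip: matrix_vector_mul_assoc)
qed

text \<open>
  A phase common to all entries cancels in \<open>M M\<^sup>*\<close>.
\<close>

lemma T_DRAP_phase:
  fixes M :: "complex ^ 'n ^ 'a"
  assumes \<alpha>: "cmod \<alpha> = 1" and y': "y' \<in> T_DRAP M r lam y"
  shows "\<alpha> *s y' \<in> T_DRAP M r lam (\<alpha> *s y)"
proof -
  let ?U = "diag_matrix (\<chi> i. \<alpha>) :: complex ^ 'a ^ 'a"
  have U: "?U *v v = \<alpha> *s v" for v by (simp add: diag_matrix_vec vec_eq_iff)
  have "\<alpha> * cnj \<alpha> = 1" using complex_norm_square[of \<alpha>] \<alpha> by simp
  then have unit: "\<alpha> * u * (cnj \<alpha> * v) = u * v" for u v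
    by (metis mult.assoc mult.left_commute mult_1)
  have "(?U ** M) ** ctranspose (?U ** M) = M ** ctranspose M"
    by (simp add: vec_eq_iff matrix_matrix_mult_def ctranspose_def diag_matrix_def
        mult_delta_left mult_delta_right if_distrib[of cnj] unit)
  then have "T_DRAP (?U ** M) r lam = T_DRAP M r lam"
    by (simp add: T_DRAP_def fun_eq_iff)
  then show ?thesis using T_DRAP_diag[of "\<chi> i. \<alpha>" y' M r lam y] \<alpha> y' by (simp add: U)
qed

section \<open>The maximal imaginary part of the linearization\<close>

lemma norm_ivec_le_sigma2:
  fixes M :: "complex ^ 'n ^ 'a"
  assumes x: "x \<bullet> (\<i> *s xhat) = 0"
  shows "norm (ivec ((ctranspose (phase_matrix (M *v xhat)) ** M) *v x)) \<le> sigma2 M xhat * norm x"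
proof (cases "x = 0")
  case True
  then show ?thesis by (simp add: ivec_simps)
next
  case False
  let ?L = "ctranspose (phase_matrix (M *v xhat)) ** M"
  have "norm (Im_vec (?L *v (x /\<^sub>R norm x))) \<le> sigma2 M xhat"
    using sigma2_attained[of xhat M] False x by (simp add: orthogonal_def)
      (metis inner_scaleR_left mult_zero_right norm_sgn sgn_div_norm inner_commute)
  then have "norm (ivec (?L *v x)) / norm x \<le> sigma2 M xhat"
    by (simp add: matrix_scaleR_vec ivec_simps divide_inverse mult.commute flip: norm_ivec)
  then show ?thesis using False by (simp add: divide_le_eq)
qed

lemma sigma2_nonneg: "0 \<le> sigma2 M xhat"
  using sigma2_attained[of xhat M] norm_ge_zero by metis

section \<open>Entrywise linearization of the projection onto the magnitude constraint\<close>

text \<open>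
  On the positive real axis the map is constant, which is why the error has \<open>\<bar>Im w\<bar>\<close> as a factor
  instead of being merely quadratic in \<open>w\<close>.
\<close>

lemma phase_projection_error:
  fixes b :: real and w :: complex
  assumes b: "0 < b" and w: "cmod w \<le> b / 2"
  shows "cmod (of_real b * ((of_real b + w) / of_real (cmod (of_real b + w))) - of_real b - \<i> * of_real (Im w))
           \<le> 4 / b * cmod w * \<bar>Im w\<bar>"
proof -
  define c t \<rho> where "c = b + Re w" and "t = Im w" and "\<rho> = cmod (of_real b + w)"
  have c: "b / 2 \<le> c"
    using abs_Re_le_cmod[of w] w unfolding c_def by linarith
  have c\<rho>: "c \<le> \<rho>"
    using complex_Re_le_cmod[of "of_real b + w"] by (simp add: c_def \<rho>_def)
  have \<rho>2: "\<rho>\<^sup>2 = c\<^sup>2 + t\<^sup>2"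
    by (simp add: \<rho>_def c_def t_def cmod_power2)
  have pos: "0 < \<rho>" "b / 2 \<le> \<rho>" "0 < c" using c c\<rho> b by linarith+
  have re: "\<bar>b * c / \<rho> - b\<bar> \<le> 2 / b * (cmod w * \<bar>t\<bar>)"
  proof -
    have t2: "t\<^sup>2 = (\<rho> - c) * (\<rho> + c)" using \<rho>2 by (simp add: power2_eq_square algebra_simps)
    have "\<rho> - c = t\<^sup>2 / (\<rho> + c)" using t2 pos by (simp add: eq_divide_eq)
    moreover have "b - b * c / \<rho> = b * (\<rho> - c) / \<rho>" using pos by (simp add: field_simps)
    ultimately have "b - b * c / \<rho> = b * t\<^sup>2 / (\<rho> * (\<rho> + c))" by simp
    then have "\<bar>b * c / \<rho> - b\<bar> = b * t\<^sup>2 / (\<rho> * (\<rho> + c))"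
      using pos b by (subst abs_minus_commute) simp
    also have "\<dots> \<le> b * t\<^sup>2 / (b / 2 * b)"
      using pos c b by (intro divide_left_mono mult_mono mult_nonneg_nonneg mult_pos_pos) auto
    also have "\<dots> = 2 / b * (\<bar>t\<bar> * \<bar>t\<bar>)"
      using b by (simp add: power2_eq_square)
    also have "\<dots> \<le> 2 / b * (cmod w * \<bar>t\<bar>)"
      using b abs_Im_le_cmod[of w] by (intro mult_left_mono mult_right_mono) (auto simp: t_def)
    finally show ?thesis .
  qed
  have im: "\<bar>b * t / \<rho> - t\<bar> \<le> 2 / b * (cmod w * \<bar>t\<bar>)"
  proof -
    have "\<bar>b - \<rho>\<bar> \<le> cmod w"
      using norm_triangle_ineq3[of "complex_of_real b" "of_real b + w"] b by (simp add: \<rho>_def)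
    moreover have "b * t / \<rho> - t = (b - \<rho>) * t / \<rho>" using pos by (simp add: field_simps)
    ultimately have "\<bar>b * t / \<rho> - t\<bar> \<le> cmod w * \<bar>t\<bar> / \<rho>"
      using pos by (simp add: abs_mult divide_right_mono mult_right_mono)
    also have "\<dots> \<le> cmod w * \<bar>t\<bar> / (b / 2)"
      using pos b by (intro divide_left_mono) auto
    finally show ?thesis by (simp add: mult_ac)
  qed
  have "cmod (of_real b * ((of_real b + w) / of_real \<rho>) - of_real b - \<i> * of_real t)
      \<le> \<bar>b * c / \<rho> - b\<bar> + \<bar>b * t / \<rho> - t\<bar>"
    using cmod_le[of "of_real b * ((of_real b + w) / of_real \<rho>) - of_real b - \<i> * of_real t"]
    by (simp add: c_def t_def Re_divide_of_real Im_divide_of_real)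
  also have "\<dots> \<le> 4 / b * cmod w * \<bar>t\<bar>" using re im by simp
  finally show ?thesis by (simp add: \<rho>_def t_def)
qed

section \<open>The linearized iteration\<close>

text \<open>
  The normalized situation: \<open>L\<close> stands for \<open>Y\<^sup>* M\<close>, and \<open>s\<close> for (an upper bound of) \<open>\<sigma>\<^sub>2\<close>.
\<close>

locale drap_linearization =
  fixes L :: "complex ^ 'n ^ 'a" and r :: "real ^ 'a" and xhat :: "complex ^ 'n"
    and lam s :: real
  assumes isometry: "ctranspose L ** L = mat 1"
    and aligned: "L *v xhat = (\<chi> i. of_real (sqrt (r $ i)))"
    and r_pos: "\<And>i. 0 < r $ i"
    and lam: "0 \<le> lam" "lam \<le> 1"
    and s: "0 \<le> s" "s < 1"
    and s_bound: "\<And>x. x \<bullet> (\<i> *s xhat) = 0 \<Longrightarrow> norm (ivec (L *v x)) \<le> s * norm x"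
begin

text \<open>
  A point in both constraint sets; up to the unitary \<open>Y\<close> it is the solution \<open>M xhat\<close>.
\<close>

definition b :: "complex ^ 'a" where
  "b = (\<chi> i. of_real (sqrt (r $ i)))"

definition proj :: "complex ^ 'a \<Rightarrow> complex ^ 'a" where
  "proj v = L *v (ctranspose L *v v)"

definition real_range :: "(complex ^ 'a) set" where
  "real_range = range (\<lambda>x. rvec (L *v x))"

text \<open>
  The real orthogonal complement of the sum of the range of \<open>L\<close> and the imaginary vectors
  (see \<open>normal_adjoint\<close>).
\<close>

definition normal :: "complex ^ 'a \<Rightarrow> bool" where
  "normal n \<longleftrightarrow> rvec n = n \<and> (\<forall>u\<in>real_range. n \<bullet> u = 0)"

text \<open>
  The first condition is orthogonality to all \<open>normal\<close> vectors; the second one removes the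
  direction in which the global phase moves \<open>b\<close>.
\<close>

definition tangent :: "complex ^ 'a \<Rightarrow> bool" where
  "tangent a \<longleftrightarrow> rvec a \<in> real_range \<and> a \<bullet> (\<i> *s b) = 0"

definition lin :: "complex ^ 'a \<Rightarrow> complex ^ 'a" where
  "lin a = proj (ivec a) + lam *\<^sub>R (rvec a - proj (rvec a))"

lemma L_xhat: "L *v xhat = b"
  by (simp add: aligned b_def)

lemma rvec_b: "rvec b = b"
  by (simp add: b_def rvec_def)

lemma rvec_ib: "rvec (\<i> *s b) = 0"
  by (simp add: b_def rvec_def vec_eq_iff)

lemma L_ixhat: "L *v (\<i> *s xhat) = \<i> *s b"
  by (simp add: vector_scalar_commute L_xhat)

lemma adjoint_left: "ctranspose L *v (L *v x) = x"
  by (simp add: matrix_vector_mul_assoc isometry)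

lemma proj_L: "proj (L *v x) = L *v x"
  by (simp add: proj_def adjoint_left)

lemma proj_b: "proj b = b"
  by (metis L_xhat proj_L)

lemma proj_idem: "proj (proj v) = proj v"
  by (simp add: proj_def adjoint_left)

lemma proj_add: "proj (v + w) = proj v + proj w"
  and proj_diff: "proj (v - w) = proj v - proj w"
  and proj_scaleR: "proj (c *\<^sub>R v) = c *\<^sub>R proj v"
  by (simp_all add: proj_def matrix_vector_right_distrib matrix_vector_mult_diff_distrib
      matrix_scaleR_vec)

lemma proj_sym: "proj v \<bullet> w = v \<bullet> proj w"
  by (metis proj_def inner_ctranspose ctranspose_ctranspose)

lemma norm_adjoint: "norm (ctranspose L *v v) = norm (proj v)"
  by (simp add: proj_def norm_isometry isometry)

text \<open>
  Pythagoras for a vector in the range of \<open>L\<close> and one in its orthogonal complement.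
\<close>

lemma norm_proj_plus:
  "(norm (proj v + c *\<^sub>R (w - proj w)))\<^sup>2 = (norm (proj v))\<^sup>2 + c\<^sup>2 * (norm (w - proj w))\<^sup>2"
proof -
  have "orthogonal (proj v) (c *\<^sub>R (w - proj w))"
    by (simp add: orthogonal_def proj_sym proj_diff proj_scaleR proj_idem)
  from norm_add_Pythagorean[OF this] show ?thesis
    by (simp add: power_mult_distrib)
qed

lemma norm_proj_split: "(norm v)\<^sup>2 = (norm (proj v))\<^sup>2 + (norm (v - proj v))\<^sup>2"
  using norm_proj_plus[of v 1 v] by simp

lemma norm_proj_le: "norm (proj v) \<le> norm v"
  by (rule power2_le_imp_le) (simp_all add: norm_proj_split[of v])

text \<open>
  The map \<open>x \<mapsto> \<i> Im (L x)\<close> and the map \<open>u \<mapsto> L\<^sup>* u\<close> on imaginary vectors are adjoint, so they have the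
  same norm; they also respect the orthogonal complements of \<open>\<i> xhat\<close> and \<open>\<i> b\<close>.
\<close>

lemma proj_imaginary_contraction:
  assumes u: "ivec u = u" and ub: "u \<bullet> (\<i> *s b) = 0"
  shows "norm (proj u) \<le> s * norm u"
proof -
  define x where "x = ctranspose L *v u"
  have Lx: "L *v x = proj u" by (simp add: x_def proj_def)
  have "x \<bullet> (\<i> *s xhat) = 0"
    using ub by (simp add: x_def inner_ctranspose L_ixhat)
  then have sb: "norm (ivec (proj u)) \<le> s * norm (proj u)"
    using s_bound[of x] norm_adjoint[of u] by (simp add: Lx) (simp add: x_def)
  have "(norm (proj u))\<^sup>2 = proj u \<bullet> u"
    by (metis power2_norm_eq_inner proj_sym proj_idem)
  also have "\<dots> = ivec (proj u) \<bullet> u"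
    by (metis u inner_ivec_left inner_commute)
  also have "\<dots> \<le> norm (ivec (proj u)) * norm u" by (rule norm_cauchy_schwarz)
  also have "\<dots> \<le> s * norm (proj u) * norm u" by (intro mult_right_mono sb) auto
  finally have "norm (proj u) * norm (proj u) \<le> norm (proj u) * (s * norm u)"
    by (simp add: power2_eq_square mult_ac)
  then show ?thesis
    using s by (cases "proj u = 0") auto
qed

text \<open>
  In terms of principal angles: if \<open>\<sigma>\<close> is a singular value of \<open>x \<mapsto> Im (L x)\<close>, then
  \<open>sqrt (1 - \<sigma>\<^sup>2)\<close> is one of \<open>x \<mapsto> Re (L x)\<close>. Apart from the kernel direction \<open>\<i> xhat\<close>, the latter are
  at least \<open>sqrt (1 - s\<^sup>2)\<close>; hence \<open>\<parallel>P u\<parallel>\<^sup>2 \<ge> (1 - s\<^sup>2) \<parallel>u\<parallel>\<^sup>2\<close>.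
\<close>

lemma coproj_real_contraction:
  assumes u: "u \<in> real_range"
  shows "norm (u - proj u) \<le> s * norm u"
proof (cases "u = 0")
  case True
  then show ?thesis by (simp add: proj_def)
next
  case False
  obtain x0 where x0: "u = rvec (L *v x0)" using u by (auto simp: real_range_def)
  \<comment> \<open>Subtracting the component along \<open>\<i> xhat\<close> does not change \<open>Re (L x)\<close>, since
    \<open>L (\<i> xhat) = \<i> b\<close> is imaginary; afterwards the bound by \<open>s\<close> applies.\<close>
  define h where "h = \<i> *s xhat"
  define x where "x = x0 - ((x0 \<bullet> h) / (h \<bullet> h)) *\<^sub>R h"
  have xh: "x \<bullet> h = 0"
    by (cases "h = 0") (simp_all add: x_def inner_diff_left)
  have ux: "u = rvec (L *v x)"
    by (simp add: x_def x0 matrix_vector_mult_diff_distrib matrix_scaleR_vec rvec_simps h_def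
        L_ixhat rvec_ib)
  have "(norm x)\<^sup>2 = (norm u)\<^sup>2 + (norm (ivec (L *v x)))\<^sup>2"
    using norm_rvec_ivec[of "L *v x"] by (simp add: norm_isometry isometry ux)
  moreover have "(norm (ivec (L *v x)))\<^sup>2 \<le> s\<^sup>2 * (norm x)\<^sup>2"
    using power_mono[OF s_bound[of x], of 2] xh by (simp add: h_def power_mult_distrib)
  ultimately have low: "(1 - s\<^sup>2) * (norm x)\<^sup>2 \<le> (norm u)\<^sup>2" by (simp add: algebra_simps)
  have "(norm u)\<^sup>2 = u \<bullet> (L *v x)"
    by (metis power2_norm_eq_inner ux inner_rvec_left)
  also have "\<dots> = (ctranspose L *v u) \<bullet> x"
    by (metis inner_ctranspose inner_commute)
  also have "\<dots> \<le> norm (proj u) * norm x"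
    using norm_cauchy_schwarz[of "ctranspose L *v u" x] by (simp add: norm_adjoint)
  finally have "((norm u)\<^sup>2)\<^sup>2 \<le> (norm (proj u))\<^sup>2 * (norm x)\<^sup>2"
    using power_mono[of "(norm u)\<^sup>2" _ 2] by (fastforce simp: power_mult_distrib)
  moreover have s2: "0 < 1 - s\<^sup>2" using s by (simp add: power_less_one_iff abs_square_less_1)
  ultimately have "(1 - s\<^sup>2) * ((norm u)\<^sup>2)\<^sup>2 \<le> (1 - s\<^sup>2) * ((norm (proj u))\<^sup>2 * (norm x)\<^sup>2)"
    by (intro mult_left_mono) auto
  also have "\<dots> = (norm (proj u))\<^sup>2 * ((1 - s\<^sup>2) * (norm x)\<^sup>2)" by (simp add: mult_ac)
  also have "\<dots> \<le> (norm (proj u))\<^sup>2 * (norm u)\<^sup>2" by (intro mult_left_mono low) auto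
  finally have "(norm u)\<^sup>2 * ((1 - s\<^sup>2) * (norm u)\<^sup>2) \<le> (norm u)\<^sup>2 * (norm (proj u))\<^sup>2"
    by (simp add: power2_eq_square mult_ac)
  then have "(1 - s\<^sup>2) * (norm u)\<^sup>2 \<le> (norm (proj u))\<^sup>2"
    using False by simp
  then have "(norm (u - proj u))\<^sup>2 \<le> (s * norm u)\<^sup>2"
    using norm_proj_split[of u] by (simp add: power_mult_distrib algebra_simps)
  then show ?thesis by (rule power2_le_imp_le) (use s in auto)
qed

lemma inner_ib_ivec: "ivec a \<bullet> (\<i> *s b) = a \<bullet> (\<i> *s b)"
proof -
  have "rvec a \<bullet> (\<i> *s b) = 0" by (simp add: inner_rvec_left[of a] rvec_ib)
  then show ?thesis by (metis add_0 inner_add_left rvec_plus_ivec)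
qed

lemma lin_contraction:
  assumes "tangent a"
  shows "norm (lin a) \<le> s * norm a"
proof (rule power2_le_imp_le)
  have "(norm (lin a))\<^sup>2 = (norm (proj (ivec a)))\<^sup>2 + lam\<^sup>2 * (norm (rvec a - proj (rvec a)))\<^sup>2"
    by (simp add: lin_def norm_proj_plus)
  also have "\<dots> \<le> (norm (proj (ivec a)))\<^sup>2 + 1 * (norm (rvec a - proj (rvec a)))\<^sup>2"
    using lam by (intro add_left_mono mult_right_mono) (auto simp: power_le_one)
  also have "\<dots> \<le> (s * norm (ivec a))\<^sup>2 + 1 * (s * norm (rvec a))\<^sup>2"
    using assms
    by (intro add_mono mult_left_mono power_mono proj_imaginary_contraction coproj_real_contraction)
       (auto simp: tangent_def inner_ib_ivec)
  also have "\<dots> = (s * norm a)\<^sup>2"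
    by (simp add: norm_rvec_ivec[of a] power_mult_distrib algebra_simps)
  finally show "(norm (lin a))\<^sup>2 \<le> (s * norm a)\<^sup>2" .
qed (use s in auto)

lemma subspace_real_range: "subspace real_range"
  unfolding real_range_def
  by (rule linear_subspace_image[OF linear_compose[OF matrix_vector_mul_linear rvec_linear, unfolded o_def]])
     auto

lemma rvec_proj_in_range: "rvec (proj v) \<in> real_range"
  by (auto simp: real_range_def proj_def)

text \<open>
  The other half of tangency, orthogonality to \<open>\<i> b\<close>, is \<open>lin_inner_ib\<close> below.
\<close>

lemma rvec_lin:
  assumes "tangent a" shows "rvec (lin a) \<in> real_range"
proof -
  have "rvec (lin a) = rvec (proj (ivec a)) + lam *\<^sub>R (rvec a - rvec (proj (rvec a)))"
    by (simp add: lin_def rvec_simps)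
  then show ?thesis
    using assms subspace_real_range rvec_proj_in_range
    by (auto simp: tangent_def intro!: subspace_add subspace_diff subspace_scale)
qed

text \<open>
  Normal vectors are orthogonal to the range of \<open>L\<close>, hence invisible in \<open>L\<^sup>* y\<close>.
\<close>

lemma normal_adjoint:
  assumes "normal n" shows "ctranspose L *v n = 0"
proof -
  define x where "x = ctranspose L *v n"
  have "x \<bullet> x = n \<bullet> (L *v x)"
    by (metis x_def inner_ctranspose inner_commute)
  also have "\<dots> = n \<bullet> rvec (L *v x)"
    using assms by (metis normal_def inner_rvec_left)
  also have "\<dots> = 0" using assms by (auto simp: normal_def real_range_def)
  finally show ?thesis by (simp add: x_def)
qed

lemma normal_inner_ib:
  assumes "normal n" shows "n \<bullet> (\<i> *s b) = 0"
  using assms inner_rvec_left[of n "\<i> *s b"] by (simp add: normal_def rvec_ib)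

lemma normal_scaleR: "normal n \<Longrightarrow> normal (c *\<^sub>R n)"
  and normal_add: "normal n \<Longrightarrow> normal n' \<Longrightarrow> normal (n + n')"
  by (simp_all add: normal_def rvec_simps inner_add_left)

text \<open>
  Errors are distributed to the contracted and the uncontracted part by orthogonal projection.
  The part \<open>e1\<close> may still have a component along \<open>\<i> b\<close>.
\<close>

lemma normal_split:
  obtains e1 e0 where "e = e1 + e0" "rvec e1 \<in> real_range" "normal e0"
    "norm e1 \<le> norm e" "norm e0 \<le> norm e"
proof -
  obtain v w where vw: "v \<in> span real_range" "\<And>u. u \<in> span real_range \<Longrightarrow> orthogonal w u"
    "rvec e = v + w"
    using orthogonal_subspace_decomp_exists[of real_range "rvec e"] by metis
  have sp: "span real_range = real_range" by (simp add: subspace_real_range span_eq_iff)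
  have rv: "rvec v = v" using vw(1) unfolding sp by (auto simp: real_range_def)
  have w: "w = rvec e - v" by (simp add: vw(3))
  have nw: "normal w"
    using vw(2) unfolding normal_def sp by (auto simp: w rvec_simps rv orthogonal_def)
  have rew: "rvec (e - w) = v"
    using nw by (simp add: rvec_simps normal_def vw(3))
  have ee: "e - w = v + ivec e"
  proof -
    have "v + ivec e + w = e" using rvec_plus_ivec[of e] by (simp add: vw(3) add_ac)
    then show ?thesis by (metis add_diff_cancel_right')
  qed
  have "orthogonal w (v + ivec e)"
    using vw(1,2) nw inner_rvec_ivec(1)[of w e]
    by (simp add: orthogonal_def inner_add_right normal_def)
  from norm_add_Pythagorean[OF this]
  have pyth: "(norm e)\<^sup>2 = (norm w)\<^sup>2 + (norm (e - w))\<^sup>2"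
    by (simp flip: ee)
  have "norm (e - w) \<le> norm e" "norm w \<le> norm e"
    by (rule power2_le_imp_le; simp add: pyth)+
  moreover have "e = (e - w) + w" "rvec (e - w) \<in> real_range"
    using vw(1) by (simp_all add: rew sp)
  ultimately show ?thesis using that nw by blast
qed

lemma T_DRAP_iff:
  "z' \<in> T_DRAP L r lam z \<longleftrightarrow> (\<exists>p\<in>phases z. \<exists>q. q = (\<chi> i. of_real (sqrt (r $ i)) * p $ i) \<and>
     z' = lam *\<^sub>R (z - proj z) + ((1 + lam) *\<^sub>R proj q - lam *\<^sub>R q))"
  by (auto simp: T_DRAP_def matrix_diff_vec matrix_scaleR_vec proj_def
      simp flip: matrix_vector_mul_assoc)

text \<open>
  The smallest measured magnitude; it determines how far the linearization is valid.
\<close>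

definition \<beta> :: real where
  "\<beta> = Min (range (\<lambda>i. sqrt (r $ i)))"

lemma \<beta>: "0 < \<beta>" "\<beta> \<le> sqrt (r $ i)"
proof -
  have "\<beta> \<in> range (\<lambda>i. sqrt (r $ i))" unfolding \<beta>_def by (intro Min_in) auto
  then show "0 < \<beta>" using r_pos by auto
  show "\<beta> \<le> sqrt (r $ i)" by (simp add: \<beta>_def)
qed

lemma \<beta>_le_norm: "\<beta> \<le> norm b"
proof -
  fix i
  have "\<beta> \<le> norm (b $ i)" using \<beta>(2)[of i] \<beta>(1) by (simp add: b_def)
  also have "\<dots> \<le> norm b" by (rule Finite_Cartesian_Product.norm_nth_le)
  finally show ?thesis .
qed

text \<open>
  The imaginary parts of \<open>a + n\<close> are those of \<open>a\<close>, which gives the factor \<open>norm a\<close>. The size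
  restriction keeps all entries away from \<open>0\<close>, so that the phases are unique.
\<close>

lemma magnitude_projection_error:
  assumes n: "normal n" and small: "norm a + norm n \<le> \<beta> / 2"
    and p: "p \<in> phases (b + a + n)"
  shows "norm ((\<chi> i. of_real (sqrt (r $ i)) * p $ i) - b - ivec a)
           \<le> 4 / \<beta> * (norm a + norm n) * norm a"
proof -
  define e where "e = (\<chi> i. of_real (sqrt (r $ i)) * p $ i) - b - ivec a"
  define K where "K = 4 / \<beta> * (norm a + norm n)"
  have "norm (e $ i) \<le> norm ((K *\<^sub>R a) $ i)" for i
  proof -
    define \<rho> w where "\<rho> = sqrt (r $ i)" and "w = a $ i + n $ i"
    have "Im (n $ i) = 0"
      using n unfolding normal_def rvec_def by (metis vec_lambda_beta Im_complex_of_real)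
    then have Imw: "Im w = Im (a $ i)" by (simp add: w_def)
    have w: "cmod w \<le> norm a + norm n"
      unfolding w_def by (intro norm_triangle_mono Finite_Cartesian_Product.norm_nth_le)
    have \<rho>: "\<beta> \<le> \<rho>" "0 < \<rho>" using \<beta>(2)[of i] \<beta>(1) by (auto simp: \<rho>_def r_pos)
    have w2: "cmod w \<le> \<rho> / 2" using w small \<rho> by linarith
    have zi: "(b + a + n) $ i = of_real \<rho> + w" by (simp add: b_def \<rho>_def w_def)
    have "of_real \<rho> + w \<noteq> 0"
    proof
      assume "of_real \<rho> + w = 0"
      then have "w = - of_real \<rho>" by (simp add: eq_neg_iff_add_eq_0 add.commute)
      then have "cmod w = \<rho>" using \<rho> by simp
      then show False using w2 \<rho> by linarith
    qed
    then have pi: "p $ i = (of_real \<rho> + w) / of_real (cmod (of_real \<rho> + w))"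
      using p zi unfolding phases_def by (metis (mono_tags, lifting) mem_Collect_eq)
    have ei: "e $ i = of_real \<rho> * ((of_real \<rho> + w) / of_real (cmod (of_real \<rho> + w)))
        - of_real \<rho> - \<i> * of_real (Im w)"
      by (simp add: e_def pi b_def \<rho>_def ivec_def Imw)
    have "norm (e $ i) \<le> 4 / \<rho> * cmod w * \<bar>Im w\<bar>"
      unfolding ei by (rule phase_projection_error) (use \<rho> w2 in auto)
    also have "\<dots> \<le> 4 / \<beta> * (norm a + norm n) * cmod (a $ i)"
      using \<rho> \<beta>(1) w abs_Im_le_cmod[of "a $ i"]
      by (intro mult_mono divide_left_mono mult_nonneg_nonneg) (auto simp: Imw)
    finally show ?thesis using \<beta>(1) by (simp add: K_def)
  qed
  then have "norm e \<le> norm (K *\<^sub>R a)" by (rule norm_le_componentwise_cart)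
  then show ?thesis using \<beta>(1) by (simp add: e_def K_def)
qed

lemma lin_inner_ib: "tangent a \<Longrightarrow> lin a \<bullet> (\<i> *s b) = 0"
proof -
  assume "tangent a"
  moreover have "proj (\<i> *s b) = \<i> *s b" by (metis L_ixhat proj_L)
  ultimately show ?thesis
    by (simp add: lin_def inner_add_left inner_diff_left proj_sym inner_ib_ivec tangent_def)
qed

text \<open>
  The constant \<open>12\<close> is \<open>3\<close> times that of \<open>magnitude_projection_error\<close>, because the map
  \<open>(1 + lam) P - lam I\<close> that transports the error has norm at most \<open>3\<close>.
\<close>

lemma drap_step_expansion:
  assumes a: "tangent a" and n: "normal n" and small: "norm a + norm n \<le> \<beta> / 2"
    and z': "z' \<in> T_DRAP L r lam (b + a + n)"
  obtains e where "z' = b + lin a + lam *\<^sub>R n + e"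
    "norm e \<le> 12 / \<beta> * (norm a + norm n) * norm a"
proof -
  obtain p q where p: "p \<in> phases (b + a + n)" and q: "q = (\<chi> i. of_real (sqrt (r $ i)) * p $ i)"
    and z'q: "z' = lam *\<^sub>R (b + a + n - proj (b + a + n)) + ((1 + lam) *\<^sub>R proj q - lam *\<^sub>R q)"
    using z' unfolding T_DRAP_iff by blast
  define e where "e = q - b - ivec a"
  have qe: "q = b + ivec a + e" by (simp add: e_def)
  have ne: "norm e \<le> 4 / \<beta> * (norm a + norm n) * norm a"
    unfolding e_def q by (rule magnitude_projection_error[OF n small p])
  have Pn: "proj n = 0" by (simp add: proj_def normal_adjoint[OF n])
  have Pa: "proj a = proj (rvec a) + proj (ivec a)" by (metis proj_add rvec_plus_ivec)
  have aa: "lam *\<^sub>R a = lam *\<^sub>R rvec a + lam *\<^sub>R ivec a"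
    by (metis scaleR_right_distrib rvec_plus_ivec)
  show ?thesis
  proof (rule that)
    show "z' = b + lin a + lam *\<^sub>R n + ((1 + lam) *\<^sub>R proj e - lam *\<^sub>R e)"
      unfolding z'q qe lin_def
      by (simp add: proj_add proj_b Pn Pa aa algebra_simps)
    have "norm ((1 + lam) *\<^sub>R proj e - lam *\<^sub>R e) \<le> (1 + lam) * norm (proj e) + lam * norm e"
      using norm_triangle_ineq4[of "(1 + lam) *\<^sub>R proj e" "lam *\<^sub>R e"] lam by simp
    also have "\<dots> \<le> 2 * norm e + 1 * norm e"
      using lam norm_proj_le by (intro add_mono mult_mono) auto
    also have "\<dots> \<le> 3 * (4 / \<beta> * (norm a + norm n) * norm a)" using ne by linarith
    also have "\<dots> = 12 / \<beta> * (norm a + norm n) * norm a" by simp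
    finally show "norm ((1 + lam) *\<^sub>R proj e - lam *\<^sub>R e) \<le> 12 / \<beta> * (norm a + norm n) * norm a" .
  qed
qed

section \<open>One step of the nonlinear iteration\<close>

text \<open>
  Half of the gap between \<open>s\<close> and \<open>1\<close> is reserved for the nonlinear error, both in the contraction
  of \<open>a\<close> and, with the same amount, in the growth of \<open>n\<close>.
\<close>

definition rate :: real where "rate = (1 + s) / 2"

text \<open>
  The error of an expanded step is multiplied by at most \<open>7\<close> when the phase is realigned, and
  \<open>7 * 12 / \<beta> * radius = (1 - s) / 2\<close>.
\<close>

definition radius :: real where "radius = \<beta> * (1 - s) / 168"

text \<open>
  The phase realignment restores orthogonality to \<open>\<i> b\<close>. It costs only a multiple of the
  linearization error \<open>e\<close>, because all other contributions to the new iterate are orthogonal to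
  \<open>\<i> b\<close> already.
\<close>

lemma drap_step:
  assumes a: "tangent a" and n: "normal n" and small: "norm a + norm n \<le> radius"
    and z': "z' \<in> T_DRAP L r lam (b + a + n)"
  obtains \<alpha> a' n' where "cmod \<alpha> = 1" "\<alpha> *s z' = b + a' + n'" "tangent a'" "normal n'"
    "norm a' \<le> rate * norm a" "norm a' + norm n' \<le> norm a + norm n"
proof -
  have "\<beta> * (1 - s) \<le> \<beta> * 1" using s \<beta>(1) by (intro mult_left_mono) auto
  then have rad: "radius \<le> \<beta> / 168" by (simp add: radius_def)
  then have "norm a + norm n \<le> \<beta> / 2" using small \<beta>(1) by linarith
  then obtain e where z'e: "z' = b + lin a + lam *\<^sub>R n + e"
    and "norm e \<le> 12 / \<beta> * (norm a + norm n) * norm a"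
    using drap_step_expansion[OF a n _ z'] by blast
  note this(2)
  also have "12 / \<beta> * (norm a + norm n) * norm a \<le> 12 / \<beta> * radius * norm a"
    using \<beta>(1) small by (intro mult_right_mono mult_left_mono) auto
  also have "12 / \<beta> * radius = (1 - s) / 14" using \<beta>(1) by (simp add: radius_def)
  finally have e: "7 * norm e \<le> (1 - s) / 2 * norm a" by simp
  have sa: "s * norm a \<le> norm a" using s by (simp add: mult_left_le_one_le)
  have lina: "norm (lin a) \<le> s * norm a" by (rule lin_contraction[OF a])
  have lamn: "norm (lam *\<^sub>R n) \<le> norm n" using lam by (simp add: mult_left_le_one_le)
  have "norm (z' - b) \<le> norm (lin a) + norm (lam *\<^sub>R n) + norm e"
    using norm_triangle_ineq[of "lin a" "lam *\<^sub>R n + e"] norm_triangle_ineq[of "lam *\<^sub>R n" e]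
    by (simp add: z'e algebra_simps del: norm_scaleR)
  moreover have "(1 - s) / 2 * norm a \<le> 1 * norm a" using s by (intro mult_right_mono) auto
  ultimately have zb: "norm (z' - b) \<le> norm b / 2"
    using e lina lamn sa small rad \<beta>_le_norm \<beta>(1) norm_ge_zero[of a] norm_ge_zero[of n] by linarith
  have nb: "0 < norm b" using \<beta>(1) \<beta>_le_norm by linarith
  have "(b - z') \<bullet> b \<le> norm (b - z') * norm b" by (rule norm_cauchy_schwarz)
  also have "\<dots> \<le> norm b / 2 * norm b" using zb by (intro mult_right_mono) (auto simp: norm_minus_commute)
  also have "\<dots> = (norm b)\<^sup>2 / 2" by (simp add: power2_eq_square)
  finally have zb2: "(norm b)\<^sup>2 / 2 \<le> z' \<bullet> b"
    unfolding inner_diff_left power2_norm_eq_inner by linarith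
  have zpos: "0 < z' \<bullet> b" 
    by (rule less_le_trans[OF _ zb2]) (use nb in simp)
  have bib: "b \<bullet> (\<i> *s b) = 0" 
    using inner_rvec_left[of b "\<i> *s b"] by (simp only: rvec_b rvec_ib inner_zero_right)
  have zib: "z' \<bullet> (\<i> *s b) = e \<bullet> (\<i> *s b)"
    by (simp add: z'e inner_add_left bib lin_inner_ib[OF a] normal_inner_ib[OF n])
  obtain \<alpha> where \<alpha>: "cmod \<alpha> = 1" "(\<alpha> *s z') \<bullet> (\<i> *s b) = 0"
    "cmod (\<alpha> - 1) \<le> 2 * \<bar>z' \<bullet> (\<i> *s b)\<bar> / (z' \<bullet> b)"
    using exists_phase[of z' b] zpos by blast
  note \<alpha>(3)
  also have "2 * \<bar>z' \<bullet> (\<i> *s b)\<bar> / (z' \<bullet> b) \<le> 2 * (norm e * norm b) / ((norm b)\<^sup>2 / 2)"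
    using Cauchy_Schwarz_ineq2[of e "\<i> *s b"] zb2 nb
    by (intro frac_le mult_left_mono) (auto simp: zib norm_smult)
  also have "\<dots> = 4 * norm e / norm b" using nb by (simp add: power2_eq_square)
  finally have \<alpha>1: "cmod (\<alpha> - 1) \<le> 4 * norm e / norm b" .
  \<comment> \<open>Realigning changes the iterate by at most \<open>6 * norm e\<close>; together with \<open>e\<close> itself this
    is the factor \<open>7\<close>.\<close>
  have "norm z' \<le> 3 / 2 * norm b"
    using zb norm_triangle_ineq[of "z' - b" b] by simp
  then have "norm ((\<alpha> - 1) *s z') \<le> 4 * norm e / norm b * (3 / 2 * norm b)"
    unfolding norm_smult using \<alpha>1 by (intro mult_mono) auto
  then have ne': "norm (e + (\<alpha> - 1) *s z') \<le> (1 - s) / 2 * norm a"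
    using e norm_triangle_ineq[of e "(\<alpha> - 1) *s z'"] nb by simp
  obtain e1 e0 where split: "e + (\<alpha> - 1) *s z' = e1 + e0" "rvec e1 \<in> real_range" "normal e0"
    "norm e1 \<le> norm (e + (\<alpha> - 1) *s z')" "norm e0 \<le> norm (e + (\<alpha> - 1) *s z')"
    using normal_split by blast
  define a' n' where "a' = lin a + e1" and "n' = lam *\<^sub>R n + e0"
  have "\<alpha> *s z' = z' + (\<alpha> - 1) *s z'"
    by (simp add: vec_eq_iff left_diff_distrib)
  also have "\<dots> = b + lin a + lam *\<^sub>R n + (e + (\<alpha> - 1) *s z')"
    by (subst (1) z'e) (simp only: add.assoc)
  also have "\<dots> = b + a' + n'"
    unfolding split(1) a'_def n'_def by (simp only: add_ac)
  finally have z'': "\<alpha> *s z' = b + a' + n'" .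
  have n': "normal n'" by (simp add: n'_def normal_add normal_scaleR n split(3))
  have "a' \<bullet> (\<i> *s b) = 0"
    using \<alpha>(2) bib normal_inner_ib[OF n'] by (simp add: z'' inner_add_left)
  then have a': "tangent a'"
    using rvec_lin[OF a] split(2) subspace_real_range
    by (simp add: tangent_def a'_def rvec_simps subspace_add)
  have na': "norm a' \<le> rate * norm a"
    using norm_triangle_ineq[of "lin a" e1] lina split(4) ne'
    unfolding a'_def rate_def by (simp add: algebra_simps)
  have nn': "norm n' \<le> norm n + (1 - s) / 2 * norm a"
    using norm_triangle_ineq[of "lam *\<^sub>R n" e0] lamn split(5) ne' unfolding n'_def by linarith
  have "norm a' + norm n' \<le> norm a + norm n"
  proof -
    have "rate * norm a + (1 - s) / 2 * norm a = norm a"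
      by (simp add: rate_def field_simps)
    then show ?thesis using na' nn' by linarith
  qed
  then show ?thesis using that \<alpha>(1) z'' a' n' na' by blast
qed

section \<open>Linear convergence\<close>

text \<open>
  The invariant tracks the iterate only up to a phase \<open>\<alpha>\<close>, which may change from step to step.
\<close>

lemma iterates_stay_close:
  assumes y0: "y 0 = L *v x0" and y: "\<And>k. y (Suc k) \<in> T_DRAP L r lam (y k)"
    and x0: "dist_opt x0 xhat \<le> radius"
  shows "\<exists>\<alpha> a n. cmod \<alpha> = 1 \<and> \<alpha> *s y k = b + a + n \<and> tangent a \<and> normal n \<and>
    norm a \<le> rate ^ k * dist_opt x0 xhat \<and> norm a + norm n \<le> dist_opt x0 xhat"
proof (induction k)
  case 0
  obtain \<alpha> where \<alpha>: "cmod \<alpha> = 1" "(\<alpha> *s x0) \<bullet> (\<i> *s xhat) = 0"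
    "dist_opt x0 xhat = norm (\<alpha> *s x0 - xhat)"
    by (rule dist_opt_aligned)
  define a where "a = L *v (\<alpha> *s x0 - xhat)"
  \<comment> \<open>The start lies in the range of \<open>L\<close>, so its deviation has no normal part.\<close>
  have "xhat \<bullet> (\<i> *s xhat) = 0"
    by (simp add: inner_vec_def inner_complex_def)
  then have "a \<bullet> (\<i> *s b) = 0"
    unfolding a_def by (simp add: inner_ctranspose adjoint_left inner_diff_left \<alpha>(2) flip: L_ixhat)
  then have "tangent a" by (auto simp: tangent_def a_def real_range_def)
  moreover have "normal 0" by (simp add: normal_def rvec_simps)
  moreover have "\<alpha> *s y 0 = b + a + 0"
    by (simp add: a_def y0 vector_scalar_commute matrix_vector_mult_diff_distrib L_xhat)
  moreover have "norm a = dist_opt x0 xhat" by (simp add: a_def norm_isometry isometry \<alpha>(3))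
  ultimately show ?case
    by (intro exI[of _ \<alpha>] exI[of _ a] exI[of _ 0]) (simp add: \<alpha>(1))
next
  case (Suc k)
  then obtain \<alpha> a n where IH: "cmod \<alpha> = 1" "\<alpha> *s y k = b + a + n" "tangent a" "normal n"
    "norm a \<le> rate ^ k * dist_opt x0 xhat" "norm a + norm n \<le> dist_opt x0 xhat"
    by blast
  have "\<alpha> *s y (Suc k) \<in> T_DRAP L r lam (b + a + n)"
    using T_DRAP_phase[OF IH(1) y[of k]] by (simp add: IH(2))
  then obtain \<alpha>' a' n' where *: "cmod \<alpha>' = 1" "\<alpha>' *s (\<alpha> *s y (Suc k)) = b + a' + n'"
    "tangent a'" "normal n'" "norm a' \<le> rate * norm a" "norm a' + norm n' \<le> norm a + norm n"
    using drap_step[OF IH(3,4) order_trans[OF IH(6) x0]] by blast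
  have "norm a' \<le> rate ^ Suc k * dist_opt x0 xhat"
  proof -
    have "rate * norm a \<le> rate * (rate ^ k * dist_opt x0 xhat)"
      using IH(5) s by (intro mult_left_mono) (auto simp: rate_def)
    with *(5) show ?thesis by (simp add: mult.assoc)
  qed
  with * IH(1,6) show ?case
    by (intro exI[of _ "\<alpha>' * \<alpha>"] exI[of _ a'] exI[of _ n'])
       (auto simp: norm_mult vector_smult_assoc)
qed

lemma linear_convergence:
  assumes "y 0 = L *v x0" and "\<And>k. y (Suc k) \<in> T_DRAP L r lam (y k)"
    and "dist_opt x0 xhat \<le> radius"
  shows "dist_opt (ctranspose L *v y k) xhat \<le> rate ^ k * dist_opt x0 xhat"
proof -
  obtain \<alpha> a n where *: "cmod \<alpha> = 1" "\<alpha> *s y k = b + a + n" "normal n"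
    "norm a \<le> rate ^ k * dist_opt x0 xhat"
    using iterates_stay_close[of y x0 k] assms by blast
  have "\<alpha> *s (ctranspose L *v y k) = ctranspose L *v (b + a + n)"
    by (simp add: vector_scalar_commute flip: *(2))
  also have "\<dots> = xhat + ctranspose L *v a"
    by (simp add: matrix_vector_right_distrib normal_adjoint[OF *(3)] adjoint_left flip: L_xhat)
  finally have "norm (\<alpha> *s (ctranspose L *v y k) - xhat) \<le> norm a"
    by (simp add: norm_adjoint norm_proj_le)
  with dist_opt_le[OF *(1)] *(4) show ?thesis by (meson order_trans)
qed

lemma rate: "s < rate" "rate < 1"
  using s by (auto simp: rate_def)

lemma radius_pos: "0 < radius"
  using s \<beta>(1) by (simp add: radius_def)

end

text \<open>
  Multiplying the measurements by the conjugate phases of \<open>M xhat\<close> leads to the normalized situation.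
\<close>

theorem drap_local_linear_convergence:
  fixes M :: "complex ^ 'n ^ 'a" and r :: "real ^ 'a" and xhat :: "complex ^ 'n"
  assumes M: "ctranspose M ** M = mat 1" and lam: "0 \<le> lam" "lam \<le> 1"
    and xhat: "\<And>i. (cmod ((M *v xhat) $ i))\<^sup>2 = r $ i" and r: "\<And>i. 0 < r $ i"
    and sigma: "sigma2 M xhat < 1"
  shows "\<exists>\<epsilon>>0. \<exists>c. sigma2 M xhat < c \<and> c < 1 \<and>
    (\<forall>x0 y k. dist_opt x0 xhat \<le> \<epsilon> \<longrightarrow> y 0 = M *v x0 \<longrightarrow>
       (\<forall>k. y (Suc k) \<in> T_DRAP M r lam (y k)) \<longrightarrow>
       dist_opt (ctranspose M *v y k) xhat \<le> c ^ k * dist_opt x0 xhat)"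
proof -
  define \<theta> where "\<theta> = (\<chi> i. cnj ((M *v xhat) $ i) / of_real (cmod ((M *v xhat) $ i)))"
  define L where "L = diag_matrix \<theta> ** M"
  have cm: "cmod ((M *v xhat) $ i) = sqrt (r $ i)" for i
    by (metis xhat norm_ge_zero real_sqrt_unique)
  have \<theta>: "cmod (\<theta> $ i) = 1" for i
    using r[of i] by (simp add: \<theta>_def norm_divide cm)
  have Y: "ctranspose (phase_matrix (M *v xhat)) = diag_matrix \<theta>"
    by (simp add: phase_matrix_def ctranspose_def diag_matrix_def \<theta>_def vec_eq_iff)
  have undo_diag: "ctranspose L *v (diag_matrix \<theta> *v v) = ctranspose M *v v" for v
  proof -
    have "ctranspose L *v (diag_matrix \<theta> *v v)
      = ctranspose M *v ((ctranspose (diag_matrix \<theta>) ** diag_matrix \<theta>) *v v)"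
      by (simp add: L_def ctranspose_mult matrix_vector_mul_assoc matrix_mul_assoc)
    then show ?thesis using diag_matrix_isometry[OF \<theta>] by simp
  qed
  interpret drap_linearization L r xhat lam "sigma2 M xhat"
  proof
    have "ctranspose L ** L = ctranspose M ** (ctranspose (diag_matrix \<theta>) ** diag_matrix \<theta>) ** M"
      by (simp add: L_def ctranspose_mult matrix_mul_assoc)
    then show "ctranspose L ** L = mat 1" using diag_matrix_isometry[OF \<theta>] M by simp
    have "\<theta> $ i * (M *v xhat) $ i = of_real (sqrt (r $ i))" for i
    proof -
      have "\<theta> $ i * (M *v xhat) $ i = of_real (r $ i) / of_real (sqrt (r $ i))"
        using complex_norm_square[of "(M *v xhat) $ i", unfolded xhat]
        by (simp add: \<theta>_def cm mult.commute)
      then show ?thesis using r[of i] by (simp add: real_div_sqrt less_imp_le flip: of_real_divide)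
    qed
    then show "L *v xhat = (\<chi> i. of_real (sqrt (r $ i)))"
      by (simp add: L_def diag_matrix_vec flip: matrix_vector_mul_assoc)
    show "norm (ivec (L *v x)) \<le> sigma2 M xhat * norm x" if "x \<bullet> (\<i> *s xhat) = 0" for x
      using norm_ivec_le_sigma2[OF that, of M] by (simp add: L_def Y)
  qed (use r lam sigma sigma2_nonneg in auto)
  have "dist_opt (ctranspose M *v y k) xhat \<le> rate ^ k * dist_opt x0 xhat"
    if "dist_opt x0 xhat \<le> radius" "y 0 = M *v x0" "\<forall>k. y (Suc k) \<in> T_DRAP M r lam (y k)" for x0 y k
    using linear_convergence[of "\<lambda>k. diag_matrix \<theta> *v y k" x0 k] that
      T_DRAP_diag[OF \<theta>, of _ M]
    by (simp add: undo_diag) (simp add: L_def matrix_vector_mul_assoc)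
  then show ?thesis using radius_pos rate by blast
qed

section \<open>The propagation matrix is an isometry\<close>

text \<open>
  Two distinct columns have as Hermitian product a multiple of the sum of all powers of a nontrivial
  root of unity.
\<close>

lemma dft_matrix_isometry:
  fixes pos :: "'n::finite \<Rightarrow> nat"
  assumes pos: "bij_betw pos UNIV {..<CARD('n)}"
  shows "ctranspose (dft_matrix pos) ** dft_matrix pos = mat 1"
proof -
  define N where "N = CARD('n)"
  have N: "0 < N" by (simp add: N_def)
  define \<omega> where "\<omega> l l' = cis (2 * pi * (real (pos l) - real (pos l')) / real N)" for l l'
  have entry: "dft_matrix pos $ k $ l = cis (- 2 * pi * real (pos k) * real (pos l) / real N) / of_real (sqrt (real N))" for k l
    by (simp add: dft_matrix_def cis_conv_exp N_def mult_ac)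
  have prod: "cnj (dft_matrix pos $ k $ l) * dft_matrix pos $ k $ l' = \<omega> l l' ^ pos k / of_nat N" for k l l'
  proof -
    have "of_real (sqrt (real N)) * of_real (sqrt (real N)) = (of_nat N :: complex)"
      by (simp flip: of_real_mult)
    moreover have "cis (2 * pi * real (pos k) * real (pos l) / real N) * cis (- 2 * pi * real (pos k) * real (pos l') / real N)
        = \<omega> l l' ^ pos k"
    proof -
      have "2 * pi * real (pos k) * real (pos l) / real N + - 2 * pi * real (pos k) * real (pos l') / real N
          = real (pos k) * (2 * pi * (real (pos l) - real (pos l')) / real N)"
        using N by (simp add: field_simps)
      then show ?thesis unfolding \<omega>_def Complex.DeMoivre cis_mult by (rule arg_cong)
    qed
    ultimately show ?thesis by (simp add: entry cis_cnj)
  qed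
  have sum: "(\<Sum>k\<in>UNIV. \<omega> l l' ^ pos k) = (\<Sum>j<N. \<omega> l l' ^ j)" for l l'
    using sum.reindex_bij_betw[OF pos, of "\<lambda>j. \<omega> l l' ^ j"] by (simp add: N_def)
  have "(\<Sum>j<N. \<omega> l l' ^ j) = (if l = l' then of_nat N else 0)" for l l'
  proof (cases "l = l'")
    case True
    then show ?thesis by (simp add: \<omega>_def)
  next
    case False
    define d where "d = (real (pos l) - real (pos l')) / real N"
    have "pos l < N" "pos l' < N" using pos by (auto simp: N_def bij_betw_def)
    moreover have "pos l \<noteq> pos l'" using pos False by (metis bij_betw_def injD)
    ultimately have d: "\<bar>d\<bar> < 1" "d \<noteq> 0" using N by (auto simp: d_def abs_if field_simps)
    have w: "\<omega> l l' = cis (2 * pi * d)" by (simp add: \<omega>_def d_def)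
    have "\<omega> l l' \<noteq> 1"
    proof
      assume "\<omega> l l' = 1"
      then have "cos (2 * pi * d) = 1" by (simp add: w complex_eq_iff)
      then obtain m :: int where "2 * pi * d = of_int m * (2 * pi)"
        by (auto simp: cos_one_2pi_int mult_ac)
      then have "d = of_int m" by simp
      then show False using d by simp
    qed
    moreover have "\<omega> l l' ^ N = 1"
    proof -
      have "\<omega> l l' ^ N = cis (real N * (2 * pi * (real (pos l) - real (pos l')) / real N))"
        unfolding \<omega>_def by (rule Complex.DeMoivre)
      also have "real N * (2 * pi * (real (pos l) - real (pos l')) / real N)
          = 2 * pi * of_int (int (pos l) - int (pos l'))"
        using N by simp
      finally have "\<omega> l l' ^ N = cis (2 * pi * of_int (int (pos l) - int (pos l')))" .
      then show ?thesis by simp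
    qed
    ultimately show ?thesis using False by (simp add: sum_gp_strict)
  qed
  then have "(\<Sum>k\<in>UNIV. cnj (dft_matrix pos $ k $ l) * dft_matrix pos $ k $ l') = (if l = l' then 1 else 0)" for l l'
    using N by (simp add: prod sum flip: sum_divide_distrib)
  then show ?thesis
    by (simp add: vec_eq_iff matrix_matrix_mult_def ctranspose_def mat_def)
qed

text \<open>
  Each block \<open>F D\<^sub>p\<close> is unitary, and the factor \<open>1 / sqrt m\<close> averages the \<open>m\<close> identities.
\<close>

lemma propagation_matrix_isometry:
  fixes pos :: "'n::finite \<Rightarrow> nat" and D :: "'m::finite \<Rightarrow> complex ^ 'n ^ 'n"
  assumes pos: "bij_betw pos UNIV {..<CARD('n)}" and D: "\<And>p. unitary_matrix (D p)"
  shows "ctranspose (propagation_matrix pos D) ** propagation_matrix pos D = mat 1"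
proof -
  define G where "G p = dft_matrix pos ** D p" for p
  have G: "ctranspose (G p) ** G p = mat 1" for p
  proof -
    have "ctranspose (G p) ** G p = ctranspose (D p) ** (ctranspose (dft_matrix pos) ** dft_matrix pos) ** D p"
      by (simp add: G_def ctranspose_mult matrix_mul_assoc)
    then show ?thesis using D[of p] by (simp add: dft_matrix_isometry[OF pos] unitary_matrix_def)
  qed
  have sq: "of_real (1 / sqrt (real CARD('m))) * of_real (1 / sqrt (real CARD('m))) = (1 / of_nat CARD('m) :: complex)"
    by (simp flip: of_real_mult)
  have "(ctranspose (propagation_matrix pos D) ** propagation_matrix pos D) $ j $ l = mat 1 $ j $ l" for j l
  proof -
    have "(ctranspose (propagation_matrix pos D) ** propagation_matrix pos D) $ j $ l
      = (\<Sum>q\<in>UNIV. 1 / of_nat CARD('m) * (cnj (G (fst q) $ snd q $ j) * G (fst q) $ snd q $ l))"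
      unfolding sq[symmetric]
      by (simp add: matrix_matrix_mult_def[where 'n = "'m \<times> 'n"] ctranspose_def propagation_matrix_def G_def
          scaleR_conv_of_real[where 'a = complex] mult_ac)
    also have "\<dots> = 1 / of_nat CARD('m) * (\<Sum>p\<in>UNIV. \<Sum>k\<in>UNIV. cnj (G p $ k $ j) * G p $ k $ l)"
      by (simp add: sum.cartesian_product sum_distrib_left case_prod_beta)
    also have "(\<Sum>p\<in>UNIV. \<Sum>k\<in>UNIV. cnj (G p $ k $ j) * G p $ k $ l)
        = (\<Sum>p\<in>(UNIV :: 'm set). mat 1 $ j $ l)"
    proof (intro sum.cong refl)
      fix p
      show "(\<Sum>k\<in>UNIV. cnj (G p $ k $ j) * G p $ k $ l) = mat 1 $ j $ l"
        using arg_cong[OF G[of p], of "\<lambda>A. A $ j $ l"]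
        by (simp add: matrix_matrix_mult_def ctranspose_def)
    qed
    finally show ?thesis by simp
  qed
  then show ?thesis by (simp add: vec_eq_iff)
qed

theorem theorem1:
  fixes pos :: "'n::finite \<Rightarrow> nat"
    and D :: "'m::finite \<Rightarrow> complex ^ 'n ^ 'n"
    and M :: "complex ^ 'n ^ ('m \<times> 'n)"
    and r :: "real ^ ('m \<times> 'n)"
    and lam :: real
    and xhat :: "complex ^ 'n"
  assumes "CARD('m) \<ge> 2"
    and "bij_betw pos UNIV {..<CARD('n)}"
    and "\<And>p. unitary_matrix (D p)"
    and "M = propagation_matrix pos D"
    and "\<And>i. 0 \<le> r $ i"
    and "0 \<le> lam" and "lam \<le> 1"
    and "\<And>i. (cmod ((M *v xhat) $ i))\<^sup>2 = r $ i"
    and "0 < Min (range (\<lambda>i. r $ i))"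
    and "sigma2 M xhat < 1"
  shows "\<exists>\<epsilon>>0. \<forall>(x :: nat \<Rightarrow> complex ^ 'n) (y :: nat \<Rightarrow> complex ^ ('m \<times> 'n)).
           norm (x 0 - xhat) < \<epsilon> \<longrightarrow>
           y 0 = M *v x 0 \<longrightarrow>
           (\<forall>k. y (Suc k) \<in> T_DRAP M r lam (y k)) \<longrightarrow>
           (\<forall>k\<ge>1. x k = ctranspose M *v y k) \<longrightarrow>
           (\<exists>c. sigma2 M xhat < c \<and> c < 1 \<and>
                (\<forall>k. dist_opt (x k) xhat \<le> c ^ k * dist_opt (x 0) xhat))"
proof -
  have M: "ctranspose M ** M = mat 1"
    unfolding assms(4) by (rule propagation_matrix_isometry[OF assms(2,3)])
  have r: "0 < r $ i" for i
    by (rule less_le_trans[OF assms(9)]) (simp add: Min_le)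
  obtain \<epsilon> c where \<epsilon>: "0 < \<epsilon>" and c: "sigma2 M xhat < c" "c < 1"
    and conv: "\<And>x0 y k. dist_opt x0 xhat \<le> \<epsilon> \<Longrightarrow> y 0 = M *v x0 \<Longrightarrow>
       (\<forall>k. y (Suc k) \<in> T_DRAP M r lam (y k)) \<Longrightarrow>
       dist_opt (ctranspose M *v y k) xhat \<le> c ^ k * dist_opt x0 xhat"
    using drap_local_linear_convergence[OF M assms(6,7,8) r assms(10)] by metis
  show ?thesis
  proof (intro exI conjI allI impI)
    fix x :: "nat \<Rightarrow> complex ^ 'n" and y :: "nat \<Rightarrow> complex ^ ('m \<times> 'n)" and k
    assume x0: "norm (x 0 - xhat) < \<epsilon>" and y0: "y 0 = M *v x 0"
      and y: "\<forall>k. y (Suc k) \<in> T_DRAP M r lam (y k)" and x: "\<forall>k\<ge>1. x k = ctranspose M *v y k"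
    have "dist_opt (x 0) xhat \<le> norm (1 *s x 0 - xhat)" by (rule dist_opt_le) simp
    then have "dist_opt (x 0) xhat \<le> \<epsilon>" using x0 by simp
    then have "dist_opt (ctranspose M *v y k) xhat \<le> c ^ k * dist_opt (x 0) xhat"
      using conv y0 y by blast
    \<comment> \<open>The relation assumed for \<open>k \<ge> 1\<close> holds for \<open>k = 0\<close> as well, since \<open>M\<close> is an isometry.\<close>
    moreover have "x k = ctranspose M *v y k"
      using x by (cases k) (simp_all add: y0 matrix_vector_mul_assoc M)
    ultimately show "dist_opt (x k) xhat \<le> c ^ k * dist_opt (x 0) xhat" by simp
  qed (use \<epsilon> c in auto)
qed

end
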